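(* Let $A\in\mathbb{R}^{m\times n}$, let $M\in\mathbb{R}^{n\times n}$ be symmetric positive definite, and let $U=(u_1,\dots,u_m)$, $V=(v_1,\dots,v_n)$, $\sigma_1\geq\dots\geq\sigma_r>0$ be a weighted SVD of $A$ with weight matrix $M$. For any integer $1\leq k<r$, $$\min_{X\in\mathbb{R}^{m\times n},\ \mathrm{rank}(X)\leq k}\|A-X\|_{M,2}\geq\sigma_{k+1},$$ where the minimum value $\sigma_{k+1}$ is achieved at $X=A_k:=\sum_{i=1}^{k}\sigma_i u_i v_i^{\top}M$.
   Context: For $x\in\mathbb{R}^n$, $\|x\|_M:=(x^{\top}Mx)^{1/2}$. For $B\in\mathbb{R}^{m\times n}$, the $M$-weighted norm is $\|B\|_{M,2}:=\max_{x\neq\mathbf{0}}\frac{\|Bx\|_2}{\|x\|_M}$. Weighted SVD (WSVD) of $A$ with weight matrix $M$: a factorization $U^{\top}AV=\begin{pmatrix}\Sigma_r&\mathbf{0}\\ \mathbf{0}&\mathbf{0}\end{pmatrix}\in\mathbb{R}^{m\times n}$, where $U=(u_1,\dots,u_m)\in\mathbb{R}^{m\times m}$ satisfies $U^{\top}U=I_m$, $V=(v_1,\dots,v_n)\in\mathbb{R}^{n\times n}$ satisfies $V^{\top}MV=I_n$, and $\Sigma_r=\mathrm{diag}(\sigma_1,\dots,\sigma_r)$ with $\sigma_1\geq\dots\geq\sigma_r>0$, $r=\mathrm{rank}(A)$. *)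

theory Defs
  imports "Jordan_Normal_Form.DL_Rank" "HOL-Analysis.Function_Topology"
begin

text \<open>Matrices and vectors are the carrier-based ones of Jordan_Normal_Form, so dimensions are
  ordinary natural numbers and all indices start at 0: \<open>u\<^sub>i\<close>, \<open>v\<^sub>i\<close> and \<open>\<sigma>\<^sub>i\<close> with \<open>1 \<le> i\<close> in
  mathematical notation are \<open>col U (i-1)\<close>, \<open>col V (i-1)\<close> and \<open>\<sigma> (i-1)\<close> here.\<close>

abbreviation mat_rank :: "real mat \<Rightarrow> nat" where
  "mat_rank A \<equiv> vec_space.rank (dim_row A) A"

definition sym_pos_def :: "nat \<Rightarrow> real mat \<Rightarrow> bool" where
  "sym_pos_def n M \<longleftrightarrow> M \<in> carrier_mat n n \<and> transpose_mat M = M \<and>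
     (\<forall>x \<in> carrier_vec n. x \<noteq> 0\<^sub>v n \<longrightarrow> x \<bullet> (M *\<^sub>v x) > 0)"

definition norm2 :: "real vec \<Rightarrow> real" where
  "norm2 x = sqrt (x \<bullet> x)"

definition weighted_norm :: "real mat \<Rightarrow> real vec \<Rightarrow> real" where
  "weighted_norm M x = sqrt (x \<bullet> (M *\<^sub>v x))"

text \<open>The maximum is taken literally, as the greatest value of the quotient; for positive definite
  \<open>M\<close> it exists by lemma \<open>weighted_mat_norm_is_max\<close> below.\<close>

definition weighted_mat_norm :: "real mat \<Rightarrow> real mat \<Rightarrow> real" where
  "weighted_mat_norm M B =
     (GREATEST c. \<exists>x \<in> carrier_vec (dim_col B). x \<noteq> 0\<^sub>v (dim_col B) \<and>
        c = norm2 (B *\<^sub>v x) / weighted_norm M x)"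

definition is_wsvd ::
  "nat \<Rightarrow> nat \<Rightarrow> real mat \<Rightarrow> real mat \<Rightarrow> real mat \<Rightarrow> real mat \<Rightarrow> (nat \<Rightarrow> real) \<Rightarrow> bool" where
  "is_wsvd m n M A U V \<sigma> \<longleftrightarrow>
     (let r = mat_rank A in
        U \<in> carrier_mat m m \<and> V \<in> carrier_mat n n \<and>
        transpose_mat U * U = 1\<^sub>m m \<and>
        transpose_mat V * M * V = 1\<^sub>m n \<and>
        transpose_mat U * A * V =
          four_block_mat (mat_diag r \<sigma>) (0\<^sub>m r (n - r))
                         (0\<^sub>m (m - r) r) (0\<^sub>m (m - r) (n - r)) \<and>
        (\<forall>i j. i \<le> j \<and> j < r \<longrightarrow> \<sigma> j \<le> \<sigma> i) \<and>
        (\<forall>i < r. 0 < \<sigma> i))"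

definition outer_prod :: "real vec \<Rightarrow> real vec \<Rightarrow> real mat" where
  "outer_prod u v = mat (dim_vec u) (dim_vec v) (\<lambda>(i, j). u $ i * v $ j)"

definition truncated_wsvd ::
  "nat \<Rightarrow> nat \<Rightarrow> real mat \<Rightarrow> real mat \<Rightarrow> real mat \<Rightarrow> (nat \<Rightarrow> real) \<Rightarrow> nat \<Rightarrow> real mat" where
  "truncated_wsvd m n M U V \<sigma> k =
     (\<Oplus>\<^bsub>module_mat TYPE(real) m n\<^esub> i \<in> {..<k}. \<sigma> i \<cdot>\<^sub>m (outer_prod (col U i) (col V i) * M))"

lemma compact_cube: "compact {x :: nat \<Rightarrow> real. \<forall>i. x i \<in> (if i < n then {-1..1} else {0})}"
proof -
  have "compactin (product_topology (\<lambda>_. euclidean) UNIV)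
      (PiE UNIV (\<lambda>i::nat. if i < n then {-1..1::real} else {0}))"
    unfolding compactin_PiE by auto
  moreover have "PiE UNIV (\<lambda>i::nat. if i < n then {-1..1::real} else {0}) =
      {x. \<forall>i. x i \<in> (if i < n then {-1..1} else {0})}"
    by (simp add: PiE_UNIV_domain Pi_def)
  ultimately show ?thesis
    by (simp add: euclidean_product_topology)
qed

lemma compact_sphere_fun:
  "compact {x :: nat \<Rightarrow> real. (\<forall>i. n \<le> i \<longrightarrow> x i = 0) \<and> (\<Sum>i<n. (x i)\<^sup>2) = 1}"
proof -
  let ?K = "{x :: nat \<Rightarrow> real. \<forall>i. x i \<in> (if i < n then {-1..1} else {0})}"
  let ?S = "{x :: nat \<Rightarrow> real. (\<Sum>i<n. (x i)\<^sup>2) = 1}"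
  have "closed ?S"
    by (intro closed_Collect_eq continuous_intros continuous_on_product_coordinates)
  then have "compact (?K \<inter> ?S)"
    using compact_cube compact_Int_closed by blast
  moreover have "\<bar>x i\<bar> \<le> 1" if "(\<Sum>i<n. (x i)\<^sup>2) = 1" "i < n" for x :: "nat \<Rightarrow> real" and i
  proof -
    have "(x i)\<^sup>2 \<le> (\<Sum>i<n. (x i)\<^sup>2)"
      using that by (intro member_le_sum) auto
    then show ?thesis using that by (simp add: abs_square_le_1)
  qed
  then have "?K \<inter> ?S = {x. (\<forall>i. n \<le> i \<longrightarrow> x i = 0) \<and> (\<Sum>i<n. (x i)\<^sup>2) = 1}"
    by (fastforce simp: abs_le_iff split: if_splits)
  ultimately show ?thesis by simp
qed

lemma quotient_attains_max:
  assumes M: "sym_pos_def n M" and B: "B \<in> carrier_mat m n" and n: "0 < n"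
  shows "\<exists>x \<in> carrier_vec n. x \<noteq> 0\<^sub>v n \<and> (\<forall>y \<in> carrier_vec n. y \<noteq> 0\<^sub>v n \<longrightarrow>
     norm2 (B *\<^sub>v y) / weighted_norm M y \<le> norm2 (B *\<^sub>v x) / weighted_norm M x)"
proof -
  let ?K = "{x :: nat \<Rightarrow> real. (\<forall>i. n \<le> i \<longrightarrow> x i = 0) \<and> (\<Sum>i<n. (x i)\<^sup>2) = 1}"
  let ?q = "\<lambda>x. norm2 (B *\<^sub>v x) / weighted_norm M x"
  have Mc: "M \<in> carrier_mat n n" using M by (simp add: sym_pos_def_def)
  have nz: "vec n x \<noteq> 0\<^sub>v n" if "x \<in> ?K" for x
  proof
    assume "vec n x = 0\<^sub>v n"
    then have "x i = 0" if "i < n" for i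
      using that by (metis index_vec index_zero_vec(1))
    then show False using that by simp
  qed
  have wpos: "0 < weighted_norm M y" if "y \<in> carrier_vec n" "y \<noteq> 0\<^sub>v n" for y
    using M that by (auto simp: sym_pos_def_def weighted_norm_def)
  have num: "norm2 (B *\<^sub>v vec n x) = sqrt (\<Sum>i<m. (\<Sum>j<n. B $$ (i,j) * x j)\<^sup>2)" for x
    using B by (simp add: norm2_def scalar_prod_def power2_eq_square atLeast0LessThan row_def)
  have den: "weighted_norm M (vec n x) = sqrt (\<Sum>i<n. x i * (\<Sum>j<n. M $$ (i,j) * x j))" for x
    using Mc by (simp add: weighted_norm_def scalar_prod_def atLeast0LessThan row_def)
  have cont: "continuous_on ?K (\<lambda>x. ?q (vec n x))"
  proof (intro continuous_on_divide ballI)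
    show "continuous_on ?K (\<lambda>x. norm2 (B *\<^sub>v vec n x))"
      unfolding num by (intro continuous_intros continuous_on_subset[OF continuous_on_product_coordinates]) simp_all
    show "continuous_on ?K (\<lambda>x. weighted_norm M (vec n x))"
      unfolding den by (intro continuous_intros continuous_on_subset[OF continuous_on_product_coordinates]) simp_all
    show "weighted_norm M (vec n x) \<noteq> 0" if "x \<in> ?K" for x
      using wpos[of "vec n x"] nz[OF that] by simp
  qed
  have "(\<lambda>i. if i = 0 then 1 else 0) \<in> ?K"
    using n by (simp add: if_distrib[of "\<lambda>x. x\<^sup>2"] cong: if_cong)
  then have ne: "?K \<noteq> {}" by (metis (no_types) empty_iff)
  obtain x where x: "x \<in> ?K" and max: "\<forall>y \<in> ?K. ?q (vec n y) \<le> ?q (vec n x)"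
    using continuous_attains_sup[OF compact_sphere_fun ne cont] by (elim bexE)
  have scale: "?q (a \<cdot>\<^sub>v y) = ?q y" if a: "0 < a" and y: "y \<in> carrier_vec n" for a y
  proof -
    have "norm2 (B *\<^sub>v (a \<cdot>\<^sub>v y)) = a * norm2 (B *\<^sub>v y)"
      using a y B by (simp add: norm2_def mult_mat_vec real_sqrt_mult)
    moreover have "weighted_norm M (a \<cdot>\<^sub>v y) = a * weighted_norm M y"
      using a y Mc by (simp add: weighted_norm_def mult_mat_vec real_sqrt_mult)
    ultimately show ?thesis using a by simp
  qed
  have "?q y \<le> ?q (vec n x)" if y: "y \<in> carrier_vec n" and y0: "y \<noteq> 0\<^sub>v n" for y
  proof -
    define s where "s = (\<Sum>i<n. (y $ i)\<^sup>2)"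
    obtain i where i: "i < n" "y $ i \<noteq> 0"
      using y y0 by (metis carrier_vecD eq_vecI index_zero_vec(1) index_zero_vec(2))
    have "(y $ i)\<^sup>2 \<le> s" unfolding s_def using i by (intro member_le_sum) auto
    moreover have "0 < (y $ i)\<^sup>2" using i by simp
    ultimately have s: "0 < s" by linarith
    define z where "z = (\<lambda>i. if i < n then y $ i / sqrt s else 0)"
    have "(\<Sum>i<n. (z i)\<^sup>2) = (\<Sum>i<n. (y $ i)\<^sup>2 / s)"
      using s by (intro sum.cong) (auto simp: z_def power_divide)
    also have "\<dots> = 1" using s by (simp add: s_def flip: sum_divide_distrib)
    finally have "z \<in> ?K" by (simp add: z_def)
    moreover have "vec n z = (1 / sqrt s) \<cdot>\<^sub>v y"
      using y by (intro eq_vecI) (auto simp: z_def)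
    ultimately show ?thesis
      using max[rule_format, of z] scale[of "1 / sqrt s" y] s y by simp
  qed
  then show ?thesis using nz[OF x] by (intro bexI[of _ "vec n x"]) auto
qed

lemma weighted_mat_norm_is_max:
  assumes "sym_pos_def n M" "B \<in> carrier_mat m n" "0 < n"
  shows "\<exists>x \<in> carrier_vec n. x \<noteq> 0\<^sub>v n \<and> weighted_mat_norm M B = norm2 (B *\<^sub>v x) / weighted_norm M x"
    and "\<And>x. x \<in> carrier_vec n \<Longrightarrow> x \<noteq> 0\<^sub>v n \<Longrightarrow>
      norm2 (B *\<^sub>v x) / weighted_norm M x \<le> weighted_mat_norm M B"
proof -
  from quotient_attains_max[OF assms] obtain x where x: "x \<in> carrier_vec n" "x \<noteq> 0\<^sub>v n"
    and max: "\<forall>y \<in> carrier_vec n. y \<noteq> 0\<^sub>v n \<longrightarrow>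
      norm2 (B *\<^sub>v y) / weighted_norm M y \<le> norm2 (B *\<^sub>v x) / weighted_norm M x"
    by blast
  have eq: "weighted_mat_norm M B = norm2 (B *\<^sub>v x) / weighted_norm M x"
    unfolding weighted_mat_norm_def
    using x max assms(2) by (intro Greatest_equality) auto
  then show "\<exists>x \<in> carrier_vec n. x \<noteq> 0\<^sub>v n \<and>
      weighted_mat_norm M B = norm2 (B *\<^sub>v x) / weighted_norm M x"
    using x by blast
  show "norm2 (B *\<^sub>v y) / weighted_norm M y \<le> weighted_mat_norm M B"
    if "y \<in> carrier_vec n" "y \<noteq> 0\<^sub>v n" for y
    using eq max that by simp
qed

end

(*
  In the coordinates x = V y the weighted norm of x is the Euclidean norm of y, and
  A V = U S with S rectangular diagonal, so |A x| = |S y|. If rank X <= k, then X kills a nonzero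
  vector x in the span of the first k + 1 columns of V; on such x the difference A - X agrees with
  A, which stretches it by at least sigma_(k+1). For the truncation, (A - A_k) V = U D, where D has
  the diagonal 0, ..., 0, sigma_(k+1), ..., sigma_r, 0, ..., 0, so no vector is stretched by more
  than sigma_(k+1); A_k has rank at most k as a sum of k matrices of rank at most one.
*)
theory Submission
  imports Defs
begin

section \<open>Rank of products and kernels of rank-deficient matrices\<close>

text \<open>Every column of \<open>A * B\<close> is \<open>A\<close> applied to a column of
  \<open>B\<close>, so the column space of the product is a subspace of that of \<open>A\<close>,
  and dimension is monotone.\<close>

lemma (in vec_space) rank_mult_le:
  assumes A: "A \<in> carrier_mat n nc" and B: "B \<in> carrier_mat nc l"
  shows "rank (A * B) \<le> rank A"
proof -
  have cA: "set (cols A) \<subseteq> carrier_vec n"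
    using A cols_dim[of A] by simp
  have cAB: "set (cols (A * B)) \<subseteq> carrier_vec n"
    using A cols_dim[of "A * B"] by simp
  have sub: "set (cols (A * B)) \<subseteq> span (set (cols A))"
  proof
    fix v assume "v \<in> set (cols (A * B))"
    then obtain j where j: "j < l" and v: "v = col (A * B) j"
      using A B by (metis carrier_matD(2) cols_length cols_nth in_set_conv_nth index_mult_mat(3))
    have "v = A *\<^sub>v col B j" using j A B v by auto
    moreover have "A *\<^sub>v col B j \<in> col_space A"
      using col_space_eq[OF A] A B j by auto
    ultimately show "v \<in> span (set (cols A))" by (simp add: col_space_def)
  qed
  have sA: "VectorSpace.subspace class_ring (span (set (cols A))) V"
    and sAB: "VectorSpace.subspace class_ring (span (set (cols (A * B)))) V"
    using span_is_subspace cA cAB by auto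
  have "span (set (cols (A * B))) \<subseteq> span (set (cols A))"
    using sub cA by (metis span_is_submodule span_is_subset)
  then have "VectorSpace.subspace class_ring (span (set (cols (A * B)))) (vs (span (set (cols A))))"
    using nested_subspaces[OF sA sAB] by simp
  moreover have "vectorspace.fin_dim class_ring (span_vs (set (cols A)))"
    "vectorspace.fin_dim class_ring (span_vs (set (cols (A * B))))"
    using fin_dim_span_cols[OF A] fin_dim_span_cols[OF mult_carrier_mat[OF A B]] by auto
  ultimately show ?thesis
    unfolding rank_def using vectorspace.subspace_dim[OF subspace_is_vs[OF sA]] by auto
qed

text \<open>Linear dependence speaks of the set of columns and so cannot see a repeated column.
  Distinct columns are dependent because independent ones would give full rank; repeated columns are
  treated separately.\<close>

lemma (in vec_space) rank_less_imp_kernel: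
  assumes A: "A \<in> carrier_mat n nc" and "rank A < nc"
  obtains v where "v \<in> carrier_vec nc" "v \<noteq> 0\<^sub>v nc" "A *\<^sub>v v = 0\<^sub>v n"
proof (cases "distinct (cols A)")
  case True
  then have "lin_dep (set (cols A))"
    using lin_indpt_full_rank[OF A True] assms(2) by auto
  then show ?thesis using lin_depE[OF A _ True] that by blast
next
  case False
  then obtain i j where ij: "i < nc" "j < nc" "i \<noteq> j" "col A i = col A j"
    using A by (auto simp: distinct_conv_nth)
  \<comment> \<open>Two equal columns cancel under the difference of the matching unit
    vectors.\<close>
  let ?v = "unit_vec nc i - unit_vec nc j :: 'a vec"
  have "A *\<^sub>v unit_vec nc l = col A l" if "l < nc" for l
    using A that by (intro eq_vecI) auto
  then have "A *\<^sub>v ?v = col A i - col A j"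
    using ij A by (simp add: mult_minus_distrib_mat_vec)
  then have "A *\<^sub>v ?v = 0\<^sub>v n" using ij A by auto
  moreover have "?v \<noteq> 0\<^sub>v nc"
  proof
    assume "?v = 0\<^sub>v nc"
    then have "?v $ i = 0" using ij(1) by (metis index_zero_vec(1))
    then show False using ij by simp
  qed
  ultimately show ?thesis using that[of ?v] by simp
qed

section \<open>Euclidean norm\<close>

lemma norm2_nonneg: "0 \<le> norm2 x"
  by (simp add: norm2_def scalar_prod_def sum_nonneg)

lemma norm2_squared: "(norm2 x)\<^sup>2 = (\<Sum>i<dim_vec x. (x $ i)\<^sup>2)"
  by (simp add: norm2_def scalar_prod_def sum_nonneg power2_eq_square atLeast0LessThan)

lemma norm2_pos:
  assumes "x \<in> carrier_vec n" "x \<noteq> 0\<^sub>v n"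
  shows "0 < norm2 x"
proof -
  obtain i where "i < n" "x $ i \<noteq> 0"
    using assms by (metis carrier_vecD eq_vecI index_zero_vec)
  then have "0 < (\<Sum>i<dim_vec x. (x $ i)\<^sup>2)"
    using assms(1) by (intro sum_pos2[of _ i]) auto
  then show ?thesis using norm2_nonneg[of x] by (simp flip: norm2_squared)
qed

section \<open>Rectangular diagonal matrices and outer products\<close>

text \<open>Replaces the block form of the WSVD: \<open>A\<close>, its truncation and their
  difference then differ only in the function \<open>d\<close>.\<close>

definition rect_diag :: "nat \<Rightarrow> nat \<Rightarrow> (nat \<Rightarrow> real) \<Rightarrow> real mat" where
  "rect_diag m n d = mat m n (\<lambda>(i, j). if i = j then d i else 0)"

lemma rect_diag_carrier [simp]: "rect_diag m n d \<in> carrier_mat m n"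
  by (simp add: rect_diag_def)

lemma rect_diag_mult_vec_index:
  assumes "y \<in> carrier_vec n" "i < m"
  shows "(rect_diag m n d *\<^sub>v y) $ i = (if i < n then d i * y $ i else 0)"
proof -
  have "(rect_diag m n d *\<^sub>v y) $ i = (\<Sum>j<n. if i = j then d i * y $ i else 0)"
    using assms
    by (auto simp: rect_diag_def scalar_prod_def atLeast0LessThan if_distrib[of "\<lambda>x. x * _"]
        cong: if_cong)
  then show ?thesis by simp
qed

lemma norm2_rect_diag_squared:
  assumes "y \<in> carrier_vec n"
  shows "(norm2 (rect_diag m n d *\<^sub>v y))\<^sup>2 = (\<Sum>i<min m n. (d i * y $ i)\<^sup>2)"
proof -
  have "(norm2 (rect_diag m n d *\<^sub>v y))\<^sup>2 = (\<Sum>i<m. if i < n then (d i * y $ i)\<^sup>2 else 0)"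
    unfolding norm2_squared using assms
    by (auto simp: rect_diag_mult_vec_index carrier_matD(1)[OF rect_diag_carrier]
        simp del: index_mult_mat_vec intro!: sum.cong)
  also have "\<dots> = (\<Sum>i\<in>{i \<in> {..<m}. i < n}. (d i * y $ i)\<^sup>2)"
    by (subst sum.inter_filter) auto
  also have "{i \<in> {..<m}. i < n} = {..<min m n}" by auto
  finally show ?thesis .
qed

lemma mult_rect_diag:
  assumes "U \<in> carrier_mat m m" and d: "\<And>j. m \<le> j \<Longrightarrow> d j = 0"
  shows "U * rect_diag m n d = mat m n (\<lambda>(a, j). if j < m then U $$ (a, j) * d j else 0)"
proof (rule eq_matI; clarsimp)
  fix a j assume aj: "a < m" "j < n"
  have "(U * rect_diag m n d) $$ (a, j) = (\<Sum>i<m. if i = j then U $$ (a, j) * d j else 0)"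
    using aj assms(1)
    by (auto simp: rect_diag_def scalar_prod_def atLeast0LessThan if_distrib[of "\<lambda>x. _ * x"]
        cong: if_cong)
  then show "(j < m \<longrightarrow> (U * rect_diag m n d) $$ (a, j) = U $$ (a, j) * d j) \<and>
    (\<not> j < m \<longrightarrow> (U * rect_diag m n d) $$ (a, j) = 0)" by simp
qed (use assms in \<open>auto simp: rect_diag_def\<close>)

text \<open>The bounds on \<open>r\<close> make the natural-number subtractions exact, so the blocks
  fit together to size \<open>m\<close> by \<open>n\<close>.\<close>

lemma four_block_mat_diag_eq_rect_diag:
  assumes "r \<le> m" "r \<le> n"
  shows "four_block_mat (mat_diag r \<sigma>) (0\<^sub>m r (n - r)) (0\<^sub>m (m - r) r) (0\<^sub>m (m - r) (n - r)) =
    rect_diag m n (\<lambda>i. if i < r then \<sigma> i else 0)"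
  using assms by (intro eq_matI) (auto simp: rect_diag_def mat_diag_def)

text \<open>In matrix notation, (u v^T) B = u (B^T v)^T. This yields both the rank bound for a
  summand of the truncation and its product with \<open>V\<close>.\<close>

lemma outer_prod_mult:
  assumes "B \<in> carrier_mat (dim_vec v) l"
  shows "outer_prod u v * B = outer_prod u (transpose_mat B *\<^sub>v v)"
proof (rule eq_matI)
  fix i j assume "i < dim_row (outer_prod u (transpose_mat B *\<^sub>v v))"
    "j < dim_col (outer_prod u (transpose_mat B *\<^sub>v v))"
  then show "(outer_prod u v * B) $$ (i, j) = outer_prod u (transpose_mat B *\<^sub>v v) $$ (i, j)"
    using assms
    by (auto simp: outer_prod_def scalar_prod_def sum_distrib_left ac_simps intro!: sum.cong)
qed (use assms in \<open>auto simp: outer_prod_def\<close>)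

section \<open>Coordinates with respect to the columns of \<open>U\<close> and
  \<open>V\<close>\<close>

text \<open>Keeps only the two orthonormality relations, without \<open>A\<close> and
  \<open>\<sigma>\<close>, so that the same facts serve \<open>A\<close>, its truncation and the
  difference.\<close>

locale weighted_frame =
  fixes m n :: nat and M U V :: "real mat"
  assumes U: "U \<in> carrier_mat m m" and V: "V \<in> carrier_mat n n" and M: "M \<in> carrier_mat n n"
    and U_orth: "transpose_mat U * U = 1\<^sub>m m"
    and V_orth: "transpose_mat V * M * V = 1\<^sub>m n"
begin

lemma norm2_U:
  assumes z: "z \<in> carrier_vec m"
  shows "norm2 (U *\<^sub>v z) = norm2 z"
proof -
  have "(U *\<^sub>v z) \<bullet> (U *\<^sub>v z) = (transpose_mat U *\<^sub>v (U *\<^sub>v z)) \<bullet> z"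
    by (rule transpose_vec_mult_scalar[OF U z, symmetric]) (use U z in auto)
  also have "transpose_mat U *\<^sub>v (U *\<^sub>v z) = (transpose_mat U * U) *\<^sub>v z"
    by (rule assoc_mult_mat_vec[symmetric]) (use U z in auto)
  also have "\<dots> = z" using U_orth z by simp
  finally show ?thesis by (simp add: norm2_def)
qed

lemma VM_V:
  assumes y: "y \<in> carrier_vec n"
  shows "(transpose_mat V * M) *\<^sub>v (V *\<^sub>v y) = y"
proof -
  have "transpose_mat V * M \<in> carrier_mat n n" using V M by auto
  then have "(transpose_mat V * M) *\<^sub>v (V *\<^sub>v y) = (transpose_mat V * M * V) *\<^sub>v y"
    using V y by (intro assoc_mult_mat_vec[symmetric])
  then show ?thesis using V_orth y by simp
qed

lemma weighted_norm_V:
  assumes y: "y \<in> carrier_vec n"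
  shows "weighted_norm M (V *\<^sub>v y) = norm2 y"
proof -
  have Vy: "V *\<^sub>v y \<in> carrier_vec n" using V y by simp
  have MVy: "M *\<^sub>v (V *\<^sub>v y) \<in> carrier_vec n" using M Vy by simp
  have "(V *\<^sub>v y) \<bullet> (M *\<^sub>v (V *\<^sub>v y)) = (M *\<^sub>v (V *\<^sub>v y)) \<bullet> (V *\<^sub>v y)"
    by (rule comm_scalar_prod[OF Vy MVy])
  also have "\<dots> = (transpose_mat V *\<^sub>v (M *\<^sub>v (V *\<^sub>v y))) \<bullet> y"
    by (rule transpose_vec_mult_scalar[OF V y MVy, symmetric])
  also have "transpose_mat V *\<^sub>v (M *\<^sub>v (V *\<^sub>v y)) = (transpose_mat V * M) *\<^sub>v (V *\<^sub>v y)"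
    by (rule assoc_mult_mat_vec[symmetric]) (use V M Vy in auto)
  also have "\<dots> = y" by (rule VM_V[OF y])
  finally show ?thesis by (simp add: norm2_def weighted_norm_def)
qed

lemma ex_V_coords:
  assumes x: "x \<in> carrier_vec n"
  obtains y where "y \<in> carrier_vec n" "x = V *\<^sub>v y"
proof -
  have W: "transpose_mat V * M \<in> carrier_mat n n" using V M by auto
  \<comment> \<open>For square matrices a left inverse is also a right inverse, so the columns of
    \<open>V\<close> span the whole space.\<close>
  have "V * (transpose_mat V * M) = 1\<^sub>m n"
    by (rule mat_mult_left_right_inverse[OF W V V_orth])
  then have "x = V *\<^sub>v ((transpose_mat V * M) *\<^sub>v x)"
    using assoc_mult_mat_vec[OF V W x] x by simp
  then show ?thesis using that mult_mat_vec_carrier[OF W x] by blast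
qed

lemma V_mult_eq_0:
  assumes "y \<in> carrier_vec n" "V *\<^sub>v y = 0\<^sub>v n"
  shows "y = 0\<^sub>v n"
proof -
  have "transpose_mat V * M \<in> carrier_mat n n" using V M by auto
  then have "(transpose_mat V * M) *\<^sub>v 0\<^sub>v n = 0\<^sub>v n"
    by (intro eq_vecI) (auto simp del: index_mult_mat)
  then show ?thesis using VM_V[OF assms(1)] assms(2) by simp
qed

text \<open>\<open>U\<close> preserves the Euclidean norm, so only the diagonal factor is left. Both
  bounds of the theorem rest on this: the lower one with \<open>B\<close> equal to \<open>A\<close>,
  the upper one with the difference.\<close>

lemma norm2_mult_V_squared:
  assumes B: "B \<in> carrier_mat m n" and BV: "B * V = U * rect_diag m n d" and y: "y \<in> carrier_vec n"
  shows "(norm2 (B *\<^sub>v (V *\<^sub>v y)))\<^sup>2 = (\<Sum>i<min m n. (d i * y $ i)\<^sup>2)"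
proof -
  have "B *\<^sub>v (V *\<^sub>v y) = U *\<^sub>v (rect_diag m n d *\<^sub>v y)"
    using BV assoc_mult_mat_vec[OF B V y] assoc_mult_mat_vec[OF U rect_diag_carrier y] by simp
  then show ?thesis
    using norm2_U[OF mult_mat_vec_carrier[OF rect_diag_carrier y]] norm2_rect_diag_squared[OF y]
    by simp
qed

section \<open>The truncated WSVD\<close>

lemma truncated_wsvd_Suc:
  "truncated_wsvd m n M U V \<sigma> (Suc k) =
    \<sigma> k \<cdot>\<^sub>m (outer_prod (col U k) (col V k) * M) + truncated_wsvd m n M U V \<sigma> k"
proof -
  interpret vectorspace class_ring "module_mat TYPE(real) m n" by (rule matrix_vs)
  \<comment> \<open>The sum is a \<open>finsum\<close> in the matrix module; a summand can be split
    off only once all summands are known to lie in the carrier.\<close>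
  have "\<sigma> i \<cdot>\<^sub>m (outer_prod (col U i) (col V i) * M) \<in> carrier (module_mat TYPE(real) m n)" for i
    using U V M by (auto simp: module_mat_simps outer_prod_def)
  then show ?thesis
    unfolding truncated_wsvd_def lessThan_Suc
    by (subst M.finsum_insert) (auto simp: module_mat_simps)
qed

text \<open>Each new summand raises the rank by at most one and fills one more diagonal entry.
  Dimension, rank and product go through one induction because the last two steps need the dimension
  of the previous sum.\<close>

lemma truncated_wsvd_properties:
  assumes "k \<le> m" "k \<le> n"
  shows "truncated_wsvd m n M U V \<sigma> k \<in> carrier_mat m n \<and>
    vec_space.rank m (truncated_wsvd m n M U V \<sigma> k) \<le> k \<and>
    truncated_wsvd m n M U V \<sigma> k * V = U * rect_diag m n (\<lambda>i. if i < k then \<sigma> i else 0)"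
  using assms
proof (induction k)
  case 0
  interpret vectorspace class_ring "module_mat TYPE(real) m n" by (rule matrix_vs)
  have T: "truncated_wsvd m n M U V \<sigma> 0 = 0\<^sub>m m n"
    by (simp add: truncated_wsvd_def module_mat_simps)
  have "rect_diag m n (\<lambda>i. if i < 0 then \<sigma> i else 0) = 0\<^sub>m m n"
    by (rule eq_matI) (auto simp: rect_diag_def)
  then show ?case using U V by (simp add: T vec_space.rank_0I)
next
  case (Suc k)
  let ?T = "truncated_wsvd m n M U V \<sigma>"
  let ?E = "\<sigma> k \<cdot>\<^sub>m (outer_prod (col U k) (col V k) * M)"
  have k: "k < m" "k < n" using Suc.prems by auto
  have O: "outer_prod (col U k) (col V k) \<in> carrier_mat m n"
    using U V by (simp add: outer_prod_def)
  have E: "?E \<in> carrier_mat m n" using O M by auto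
  have T: "?T k \<in> carrier_mat m n" and rank_T: "vec_space.rank m (?T k) \<le> k"
    and TV: "?T k * V = U * rect_diag m n (\<lambda>i. if i < k then \<sigma> i else 0)"
    using Suc by auto
  \<comment> \<open>The entries factor into a row part and a column part, since multiplying an outer
    product by \<open>M\<close> leaves an outer product.\<close>
  have "vec_space.rank m ?E \<le> 1"
  proof (rule vec_space.rank_le_1_product_entries[OF E])
    fix i j assume "i < dim_row ?E" "j < dim_col ?E"
    then show "?E $$ (i, j) = \<sigma> k * col U k $ i * (transpose_mat M *\<^sub>v col V k) $ j"
      using U V M by (subst outer_prod_mult) (auto simp: outer_prod_def)
  qed
  then have "vec_space.rank m (?T (Suc k)) \<le> Suc k"
    using vec_space.rank_subadditive[OF E T] rank_T by (simp add: truncated_wsvd_Suc)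
  moreover have "?T (Suc k) * V = U * rect_diag m n (\<lambda>i. if i < Suc k then \<sigma> i else 0)"
  proof -
    have MV: "M * V \<in> carrier_mat n n" using M V by simp
    \<comment> \<open>This vector is the transpose of the row v_k^T M V. By the transposed relation
      V^T M V = I it is the k-th unit vector.\<close>
    have "transpose_mat (M * V) *\<^sub>v col V k = col (transpose_mat (M * V) * V) k"
      using V k by auto
    also have "transpose_mat (M * V) * V = transpose_mat (transpose_mat V * (M * V))"
      using transpose_mult[of "transpose_mat V" n n "M * V" n] V MV by simp
    also have "transpose_mat V * (M * V) = 1\<^sub>m n"
      using V_orth V M by (metis assoc_mult_mat transpose_carrier_mat)
    finally have coord: "transpose_mat (M * V) *\<^sub>v col V k = unit_vec n k"
      using k by simp
    have "?E * V = \<sigma> k \<cdot>\<^sub>m (outer_prod (col U k) (col V k) * (M * V))"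
      using O M V by (metis assoc_mult_mat mult_carrier_mat mult_smult_assoc_mat)
    also have "outer_prod (col U k) (col V k) * (M * V) = outer_prod (col U k) (unit_vec n k)"
      using outer_prod_mult[of "M * V" "col V k" n "col U k"] MV V coord by simp
    finally have EV: "?E * V = \<sigma> k \<cdot>\<^sub>m outer_prod (col U k) (unit_vec n k)" .
    have "?T (Suc k) * V = ?E * V + ?T k * V"
      unfolding truncated_wsvd_Suc by (rule add_mult_distrib_mat[OF E T V])
    \<comment> \<open>The new summand is nonzero at most in column \<open>k\<close>, where it is
      \<open>\<sigma> k\<close> times column \<open>k\<close> of \<open>U\<close>; the previous
      product vanishes there.\<close>
    also have "\<dots> = U * rect_diag m n (\<lambda>i. if i < Suc k then \<sigma> i else 0)"
      unfolding EV TV using U k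
      by (simp add: mult_rect_diag) (rule eq_matI, auto simp: outer_prod_def less_Suc_eq)
    finally show ?thesis .
  qed
  ultimately show ?case using E T by (simp add: truncated_wsvd_Suc)
qed

end

section \<open>The lower bound and its attainment\<close>

theorem theorem3p2:
  fixes m n k :: nat and A M U V :: "real mat" and \<sigma> :: "nat \<Rightarrow> real"
  assumes "A \<in> carrier_mat m n"
    and "sym_pos_def n M"
    and "is_wsvd m n M A U V \<sigma>"
    and "1 \<le> k" and "k < mat_rank A"
  shows "(\<forall>X \<in> carrier_mat m n. mat_rank X \<le> k \<longrightarrow> weighted_mat_norm M (A - X) \<ge> \<sigma> k) \<and>
    is_arg_min (\<lambda>X. weighted_mat_norm M (A - X)) (\<lambda>X. X \<in> carrier_mat m n \<and> mat_rank X \<le> k)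
      (truncated_wsvd m n M U V \<sigma> k) \<and>
    weighted_mat_norm M (A - truncated_wsvd m n M U V \<sigma> k) = \<sigma> k"
proof -
  note A = assms(1) and pd = assms(2)
  define r where "r = mat_rank A"
  \<comment> \<open>The WSVD constrains \<open>\<sigma>\<close> only below \<open>r\<close>; cutting
    it off to 0 gives the full diagonal.\<close>
  define s where "s = (\<lambda>i. if i < r then \<sigma> i else 0)"
  let ?S = "four_block_mat (mat_diag r \<sigma>) (0\<^sub>m r (n - r)) (0\<^sub>m (m - r) r) (0\<^sub>m (m - r) (n - r))"
  have U: "U \<in> carrier_mat m m" and V: "V \<in> carrier_mat n n"
    and orth: "transpose_mat U * U = 1\<^sub>m m" "transpose_mat V * M * V = 1\<^sub>m n"
    and UAV: "transpose_mat U * A * V = ?S"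
    and mono: "\<And>i j. i \<le> j \<Longrightarrow> j < r \<Longrightarrow> \<sigma> j \<le> \<sigma> i" and pos: "\<And>i. i < r \<Longrightarrow> 0 < \<sigma> i"
    using assms(3) unfolding is_wsvd_def Let_def r_def by blast+
  interpret weighted_frame m n M U V
    using U V orth pd by unfold_locales (auto simp: sym_pos_def_def)
  \<comment> \<open>The block matrix has dimensions \<open>r + (m - r)\<close> and
    \<open>r + (n - r)\<close> with truncated subtraction; these equal \<open>m\<close> and
    \<open>n\<close> only if \<open>r\<close> exceeds neither.\<close>
  have "dim_row ?S = m" "dim_col ?S = n" using U V unfolding UAV[symmetric] by auto
  then have rm: "r \<le> m" and rn: "r \<le> n" by (auto simp: mat_diag_def)
  have kr: "k < r" using assms(5) by (simp add: r_def)
  then have k: "k \<le> m" "k \<le> n" and kmin: "k < min m n" and n0: "0 < n" using rm rn by auto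
  have AV: "A * V = U * rect_diag m n s"
  proof -
    have "U * transpose_mat U = 1\<^sub>m m"
      using mat_mult_left_right_inverse[OF _ U orth(1)] U by simp
    then have "A * V = U * transpose_mat U * (A * V)"
      using left_mult_one_mat[OF mult_carrier_mat[OF A V]] by simp
    also have "\<dots> = U * (transpose_mat U * (A * V))"
      by (rule assoc_mult_mat) (use U A V in auto)
    also have "transpose_mat U * (A * V) = transpose_mat U * A * V"
      by (rule assoc_mult_mat[symmetric]) (use U A V in auto)
    finally show ?thesis
      unfolding UAV four_block_mat_diag_eq_rect_diag[OF rm rn] s_def .
  qed
  have lower: "\<sigma> k \<le> weighted_mat_norm M (A - X)"
    if X: "X \<in> carrier_mat m n" and rank_X: "mat_rank X \<le> k" for X
  proof -
    \<comment> \<open>\<open>V * E\<close> consists of the first \<open>k + 1\<close> columns of \<open>V\<close>, so \<open>V *\<^sub>v y\<close> below lies in their span.\<close>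
    define E where "E = rect_diag n (Suc k) (\<lambda>_. 1)"
    have Ec: "E \<in> carrier_mat n (Suc k)" by (simp add: E_def)
    have VE: "V * E \<in> carrier_mat n (Suc k)" using V Ec by simp
    \<comment> \<open>This matrix has \<open>Suc k\<close> columns but rank at most that of
      \<open>X\<close>, hence a nontrivial kernel.\<close>
    have "vec_space.rank m (X * (V * E)) < Suc k"
      using vec_space.rank_mult_le[OF X VE] rank_X X by simp
    then obtain v where v: "v \<in> carrier_vec (Suc k)" "v \<noteq> 0\<^sub>v (Suc k)"
      and Xv: "X * (V * E) *\<^sub>v v = 0\<^sub>v m"
      using vec_space.rank_less_imp_kernel[OF mult_carrier_mat[OF X VE]] by blast
    define y where "y = E *\<^sub>v v"
    have y: "y \<in> carrier_vec n" using Ec v by (simp add: y_def)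
    \<comment> \<open>\<open>y\<close> is \<open>v\<close> padded with zeros, so sums over its
      entries stop at index \<open>k\<close>.\<close>
    have y_index: "y $ i = (if i \<le> k then v $ i else 0)" if "i < n" for i
      using rect_diag_mult_vec_index[OF v(1) that] by (simp add: y_def E_def less_Suc_eq_le)
    obtain i where "i < Suc k" "v $ i \<noteq> 0"
      using v by (metis carrier_vecD eq_vecI index_zero_vec)
    then have y0: "y \<noteq> 0\<^sub>v n"
      using y_index[of i] kmin
      by (metis index_zero_vec(1) less_Suc_eq_le min_less_iff_conj order_le_less_trans)
    let ?x = "V *\<^sub>v y"
    have x: "?x \<in> carrier_vec n" "?x \<noteq> 0\<^sub>v n"
      using V y y0 V_mult_eq_0 by auto
    have "X *\<^sub>v ?x = 0\<^sub>v m"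
      using Xv X V Ec VE v by (simp add: y_def)
    then have Ax: "(A - X) *\<^sub>v ?x = A *\<^sub>v ?x"
      using A X x(1) by (simp add: minus_mult_distrib_mat_vec)
    have "(\<sigma> k * norm2 y)\<^sup>2 = (\<Sum>i<n. (\<sigma> k * y $ i)\<^sup>2)"
      using y by (simp add: power_mult_distrib norm2_squared sum_distrib_left)
    also have "\<dots> = (\<Sum>i<Suc k. (\<sigma> k * y $ i)\<^sup>2)"
      using kmin y_index by (intro sum.mono_neutral_right) auto
    \<comment> \<open>For \<open>i \<le> k < r\<close> the value \<open>s i\<close> is
      \<open>\<sigma> i\<close>, and by monotonicity it is at least the positive
      \<open>\<sigma> k\<close>.\<close>
    also have "\<dots> \<le> (\<Sum>i<Suc k. (s i * y $ i)\<^sup>2)"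
      using kr mono pos[OF kr]
      by (intro sum_mono) (auto simp: s_def power_mult_distrib less_Suc_eq_le
          intro!: mult_right_mono power_mono)
    also have "\<dots> \<le> (\<Sum>i<min m n. (s i * y $ i)\<^sup>2)"
      using kmin by (intro sum_mono2) auto
    also have "\<dots> = (norm2 ((A - X) *\<^sub>v ?x))\<^sup>2"
      unfolding Ax norm2_mult_V_squared[OF A AV y] ..
    finally have "\<sigma> k * norm2 y \<le> norm2 ((A - X) *\<^sub>v ?x)"
      using norm2_nonneg by (rule power2_le_imp_le)
    then have "\<sigma> k \<le> norm2 ((A - X) *\<^sub>v ?x) / weighted_norm M ?x"
      using norm2_pos[OF y y0] weighted_norm_V[OF y] by (simp add: pos_le_divide_eq)
    also have "\<dots> \<le> weighted_mat_norm M (A - X)"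
      by (rule weighted_mat_norm_is_max(2)[OF pd minus_carrier_mat[OF X] n0 x])
    finally show ?thesis .
  qed
  let ?T = "truncated_wsvd m n M U V \<sigma> k"
  let ?t = "\<lambda>i. if i < k then \<sigma> i else 0"
  have T: "?T \<in> carrier_mat m n" and rank_T: "mat_rank ?T \<le> k"
    and TV: "?T * V = U * rect_diag m n ?t"
    using truncated_wsvd_properties[OF k, of \<sigma>] by auto
  have DV: "(A - ?T) * V = U * rect_diag m n (\<lambda>i. s i - ?t i)"
  proof -
    have "(A - ?T) * V = U * rect_diag m n s - U * rect_diag m n ?t"
      using minus_mult_distrib_mat[OF A T V] AV TV by simp
    also have "\<dots> = U * (rect_diag m n s - rect_diag m n ?t)"
      by (rule mult_minus_distrib_mat[OF U rect_diag_carrier rect_diag_carrier, symmetric])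
    also have "rect_diag m n s - rect_diag m n ?t = rect_diag m n (\<lambda>i. s i - ?t i)"
      by (rule eq_matI) (auto simp: rect_diag_def)
    finally show ?thesis .
  qed
  have D: "A - ?T \<in> carrier_mat m n" using T by (rule minus_carrier_mat)
  \<comment> \<open>Three ranges: below \<open>k\<close> the difference cancels, from
    \<open>k\<close> to \<open>r - 1\<close> it is \<open>\<sigma> i \<le> \<sigma> k\<close>, and
    from \<open>r\<close> on it is 0.\<close>
  have diff_bound: "(s i - ?t i)\<^sup>2 \<le> (\<sigma> k)\<^sup>2" for i
    using kr mono[of k i] pos[of i] by (auto simp: s_def intro!: power_mono)
  have upper: "weighted_mat_norm M (A - ?T) \<le> \<sigma> k"
  proof -
    \<comment> \<open>The norm is an attained maximum, so it suffices to bound the quotient at one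
      maximiser.\<close>
    obtain x where x: "x \<in> carrier_vec n" "x \<noteq> 0\<^sub>v n"
      and max: "weighted_mat_norm M (A - ?T) = norm2 ((A - ?T) *\<^sub>v x) / weighted_norm M x"
      using weighted_mat_norm_is_max(1)[OF pd D n0] by blast
    obtain y where y: "y \<in> carrier_vec n" and xy: "x = V *\<^sub>v y"
      using ex_V_coords[OF x(1)] .
    have y0: "y \<noteq> 0\<^sub>v n" using x(2) V xy by auto
    have "(norm2 ((A - ?T) *\<^sub>v x))\<^sup>2 = (\<Sum>i<min m n. ((s i - ?t i) * y $ i)\<^sup>2)"
      unfolding xy by (rule norm2_mult_V_squared[OF D DV y])
    also have "\<dots> \<le> (\<Sum>i<min m n. (\<sigma> k * y $ i)\<^sup>2)"
      unfolding power_mult_distrib by (intro sum_mono mult_right_mono diff_bound) auto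
    also have "\<dots> \<le> (\<Sum>i<n. (\<sigma> k * y $ i)\<^sup>2)"
      by (intro sum_mono2) auto
    also have "\<dots> = (\<sigma> k * norm2 y)\<^sup>2"
      using y by (simp add: power_mult_distrib norm2_squared sum_distrib_left)
    finally have "norm2 ((A - ?T) *\<^sub>v x) \<le> \<sigma> k * norm2 y"
      by (rule power2_le_imp_le) (use pos[OF kr] norm2_nonneg[of y] in auto)
    then show ?thesis
      unfolding max xy weighted_norm_V[OF y] using norm2_pos[OF y y0]
      by (simp add: pos_divide_le_eq)
  qed
  \<comment> \<open>The truncation is itself a competitor, so the lower bound applies to it as
    well.\<close>
  have eq: "weighted_mat_norm M (A - ?T) = \<sigma> k"
    using upper lower[OF T rank_T] by simp
  then show ?thesis
    using lower T rank_T by (auto simp: is_arg_min_def not_less)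
qed

end
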